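(* Consider the primal-dual pair $$(P_1)\ \min_{x\in Q}\{f(x):\mathbf{A}x=b\},\qquad (P_2)\ \min_{\lambda\in\Lambda}\phi(\lambda),\quad \phi(\lambda)=\langle\lambda,b\rangle+\max_{x\in Q}\left(-f(x)-\langle\mathbf{A}^T\lambda,x\rangle\right),$$ in the setting described in the context. Assume $f$ is $\gamma$-strongly convex with respect to $\|\cdot\|_E$ and that $(P_2)$ has a solution $\lambda^*$ with $\|\lambda^*\|_2\le R$. Let $x^*$ be the solution of $(P_1)$. Then the sequences $\hat x^k,\eta^k$ generated by the Primal-Dual AAM algorithm (defined in the context) with $n$ blocks of dual variables satisfy, for $k\ge1$, $$|\phi(\eta^k)+f(\hat x^k)|\le\frac{8n\|\mathbf{A}\|_{E\to H}^2R^2}{\gamma k^2},\qquad \|\mathbf{A}\hat x^k-b\|_2\le\frac{8n\|\mathbf{A}\|_{E\to H}^2R}{\gamma k^2},\qquad \|\hat x^k-x^*\|_E\le\frac{4n\|\mathbf{A}\|_{E\to H}R}{\gamma k}.$$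
   Context: $E$ is a finite-dimensional real vector space with norm $\|\cdot\|_E$; $Q\subseteq E$ is a closed convex set; $f$ is a $\gamma$-strongly convex function on $Q$; $\mathbf{A}:E\to H$ is linear, $H$ is a finite-dimensional real space with the Euclidean norm $\|\cdot\|_H=\|\cdot\|_2$; $b\in H$; $\Lambda=H^*$ (identified with $H$, with the Euclidean norm). $\|\mathbf{A}\|_{E\to H}=\max\{\langle \mathbf{A}u,v\rangle:\|u\|_E=1,\|v\|_H=1\}$. It is assumed that $\phi$ has Lipschitz-continuous gradient. $x(\lambda)$ denotes a solution of $\max_{x\in Q}(-f(x)-\langle\mathbf{A}^T\lambda,x\rangle)$, and $\nabla\phi(\lambda)=b-\mathbf{A}x(\lambda)$. The coordinates of $\lambda$ are partitioned into $n$ blocks; $S_p(\lambda)$ is the affine subspace of all points differing from $\lambda$ only in block $p$, $\nabla_p\phi$ is the part of the gradient corresponding to block $p$, and $\min_{\eta\in S_p(\lambda)}\phi(\eta)$ is assumed to have a solution for every $p,\lambda$. Primal-Dual AAM algorithm: set $A_0=0$, $\eta^0=\zeta^0=0$ ($\hat x^0$ is irrelevant as $A_0=0$). For $k=0,1,2,\dots$: 1. $\beta_k\in\arg\min_{\beta\in[0,1]}\phi(\eta^k+\beta(\zeta^k-\eta^k))$ and $\lambda^k=\beta_k\zeta^k+(1-\beta_k)\eta^k$. 2. $i_k\in\arg\max_{i\in\{1,\dots,n\}}\|\nabla_i\phi(\lambda^k)\|_2^2$. 3. $\eta^{k+1}\in\arg\min_{\eta\in S_{i_k}(\lambda^k)}\phi(\eta)$.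 4. Find $a_{k+1}>0$, $A_{k+1}=A_k+a_{k+1}$ such that $\phi(\lambda^k)-\frac{a_{k+1}^2}{2A_{k+1}}\|\nabla\phi(\lambda^k)\|_2^2=\phi(\eta^{k+1})$. 5. $\zeta^{k+1}=\zeta^k-a_{k+1}\nabla\phi(\lambda^k)$. 6. $\hat x^{k+1}=\dfrac{a_{k+1}x(\lambda^k)+A_k\hat x^k}{A_{k+1}}$. The algorithm is run as long as $\nabla\phi(\lambda^k)\ne0$. *)

theory Defs
  imports "HOL-Analysis.Analysis"
begin

definition strongly_convex_on :: "real \<Rightarrow> 'e::real_normed_vector set \<Rightarrow> ('e \<Rightarrow> real) \<Rightarrow> bool" where
  "strongly_convex_on \<gamma> Q f \<longleftrightarrow> convex Q \<and>
     (\<forall>x\<in>Q. \<forall>y\<in>Q. \<forall>t\<in>{0..1}.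
        f (t *\<^sub>R x + (1 - t) *\<^sub>R y)
          \<le> t * f x + (1 - t) * f y - \<gamma> / 2 * t * (1 - t) * (norm (x - y))\<^sup>2)"

(* The adjoint takes values in the dual space: A^T l is the functional x |-> <l, A x>,
   so that <A^T l, x> is the application  adj A l x. *)
definition adj :: "('e::real_normed_vector \<Rightarrow> 'h::real_inner) \<Rightarrow> 'h \<Rightarrow> 'e \<Rightarrow> real" where
  "adj A l = (\<lambda>x. l \<bullet> A x)"

(* The supremum is the maximum whenever the latter is attained; otherwise its value need not
   be meaningful. *)
definition dual_fun ::
  "'e::real_normed_vector set \<Rightarrow> ('e \<Rightarrow> real) \<Rightarrow> ('e \<Rightarrow> 'h::real_inner) \<Rightarrow> 'h \<Rightarrow> 'h \<Rightarrow> real" where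
  "dual_fun Q f A b l = l \<bullet> b + (SUP x\<in>Q. - f x - adj A l x)"

(* n blocks of coordinates, numbered 1, ..., n *)
definition block_partition :: "nat \<Rightarrow> (nat \<Rightarrow> 'm set) \<Rightarrow> bool" where
  "block_partition n B \<longleftrightarrow> partition_on UNIV (B ` {1..n}) \<and> inj_on B {1..n}"

definition block_subspace :: "'m set \<Rightarrow> real^'m \<Rightarrow> (real^'m) set" where
  "block_subspace P l = {\<eta>. \<forall>j. j \<notin> P \<longrightarrow> \<eta> $ j = l $ j}"

definition block_part :: "'m set \<Rightarrow> real^'m \<Rightarrow> real^'m" where
  "block_part P v = (\<chi> j. if j \<in> P then v $ j else 0)"

(* Iteration k of the method: \<phi> is the dual objective, d\<phi> its gradient, x l a maximiser of the
   inner problem at l. The scalars called A_k in the usual presentation are written w k. *)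
definition aam_iteration ::
  "nat \<Rightarrow> (nat \<Rightarrow> 'm set) \<Rightarrow> (real^'m \<Rightarrow> real) \<Rightarrow> (real^'m \<Rightarrow> real^'m) \<Rightarrow>
   (real^'m \<Rightarrow> 'e::real_normed_vector) \<Rightarrow>
   (nat \<Rightarrow> real) \<Rightarrow> (nat \<Rightarrow> real^'m) \<Rightarrow> (nat \<Rightarrow> nat) \<Rightarrow> (nat \<Rightarrow> real^'m) \<Rightarrow>
   (nat \<Rightarrow> real) \<Rightarrow> (nat \<Rightarrow> real) \<Rightarrow> (nat \<Rightarrow> real^'m) \<Rightarrow> (nat \<Rightarrow> 'e) \<Rightarrow> nat \<Rightarrow> bool" where
  "aam_iteration n B \<phi> d\<phi> x \<beta> l i \<eta> a w \<zeta> xh k \<longleftrightarrow>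
     is_arg_min (\<lambda>s. \<phi> (\<eta> k + s *\<^sub>R (\<zeta> k - \<eta> k))) (\<lambda>s. s \<in> {0..1}) (\<beta> k) \<and>
     l k = \<beta> k *\<^sub>R \<zeta> k + (1 - \<beta> k) *\<^sub>R \<eta> k \<and>
     d\<phi> (l k) \<noteq> 0 \<and>
     is_arg_max (\<lambda>p. (norm (block_part (B p) (d\<phi> (l k))))\<^sup>2) (\<lambda>p. p \<in> {1..n}) (i k) \<and>
     is_arg_min \<phi> (\<lambda>y. y \<in> block_subspace (B (i k)) (l k)) (\<eta> (Suc k)) \<and>
     a (Suc k) > 0 \<and>
     w (Suc k) = w k + a (Suc k) \<and>
     \<phi> (l k) - (a (Suc k))\<^sup>2 / (2 * w (Suc k)) * (norm (d\<phi> (l k)))\<^sup>2 = \<phi> (\<eta> (Suc k)) \<and>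
     \<zeta> (Suc k) = \<zeta> k - a (Suc k) *\<^sub>R d\<phi> (l k) \<and>
     xh (Suc k) = (1 / w (Suc k)) *\<^sub>R (a (Suc k) *\<^sub>R x (l k) + w k *\<^sub>R xh k)"

(* The first N iterations of a run, N = \<infinity> for a run that never stops. Each of them is carried
   out only if the gradient does not vanish, and xh 0 is arbitrary. *)
definition aam_run ::
  "nat \<Rightarrow> (nat \<Rightarrow> 'm set) \<Rightarrow> (real^'m \<Rightarrow> real) \<Rightarrow> (real^'m \<Rightarrow> real^'m) \<Rightarrow>
   (real^'m \<Rightarrow> 'e::real_normed_vector) \<Rightarrow>
   (nat \<Rightarrow> real) \<Rightarrow> (nat \<Rightarrow> real^'m) \<Rightarrow> (nat \<Rightarrow> nat) \<Rightarrow> (nat \<Rightarrow> real^'m) \<Rightarrow>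
   (nat \<Rightarrow> real) \<Rightarrow> (nat \<Rightarrow> real) \<Rightarrow> (nat \<Rightarrow> real^'m) \<Rightarrow> (nat \<Rightarrow> 'e) \<Rightarrow> enat \<Rightarrow> bool" where
  "aam_run n B \<phi> d\<phi> x \<beta> l i \<eta> a w \<zeta> xh N \<longleftrightarrow>
     w 0 = 0 \<and> \<eta> 0 = 0 \<and> \<zeta> 0 = 0 \<and>
     (\<forall>k. enat k < N \<longrightarrow> aam_iteration n B \<phi> d\<phi> x \<beta> l i \<eta> a w \<zeta> xh k)"

(* onorm is the norm of A as the supremum of <A u, v> over unit vectors u, v. *)
lemma onorm_eq_Sup_inner:
  fixes A :: "'e::real_normed_vector \<Rightarrow> real^'m"
  assumes A: "bounded_linear A" and nontrivial: "\<exists>u::'e. u \<noteq> 0"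
  shows "onorm A = Sup {A u \<bullet> v | u v. norm u = 1 \<and> norm v = 1}"
proof (rule antisym)
  let ?S = "{A u \<bullet> v | u v. norm u = 1 \<and> norm v = 1}"
  have le: "z \<le> onorm A" if "z \<in> ?S" for z
  proof -
    from that obtain u v where z: "z = A u \<bullet> v" and uv: "norm u = 1" "norm v = 1" by blast
    have "z \<le> norm (A u) * norm v" unfolding z by (rule norm_cauchy_schwarz)
    also have "\<dots> \<le> onorm A" using onorm[OF A, of u] uv by simp
    finally show ?thesis .
  qed
  have bdd: "bdd_above ?S" by (rule bdd_aboveI) (rule le)
  obtain u0 :: 'e where "u0 \<noteq> 0" using nontrivial by blast
  then have u1: "norm (sgn u0) = 1" by (simp add: norm_sgn)
  have unit: "norm (A u) \<le> Sup ?S" if u: "norm u = 1" for u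
  proof -
    have "\<exists>v::real^'m. norm v = 1 \<and> A u \<bullet> v = norm (A u)"
    proof (cases "A u = 0")
      case True
      then show ?thesis by (auto intro: exI[of _ "axis undefined 1"])
    next
      case False
      then have "A u \<bullet> sgn (A u) = norm (A u)"
        by (simp add: sgn_div_norm dot_square_norm power2_eq_square)
      with False show ?thesis by (intro exI[of _ "sgn (A u)"]) (simp add: norm_sgn)
    qed
    then have "norm (A u) \<in> ?S" using u by force
    then show ?thesis using bdd by (rule cSup_upper)
  qed
  have "norm (A u) \<le> Sup ?S * norm u" for u
  proof (cases "u = 0")
    case True
    then show ?thesis using A by (simp add: linear_simps)
  next
    case False
    have "norm (A (sgn u)) \<le> Sup ?S" using False by (intro unit) (simp add: norm_sgn)
    moreover have "norm (A (sgn u)) = norm (A u) / norm u"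
      using A by (simp add: sgn_div_norm linear_simps divide_inverse mult.commute)
    ultimately show ?thesis using False by (simp add: pos_divide_le_eq)
  qed
  moreover have "0 \<le> Sup ?S" using unit[OF u1] norm_ge_zero[of "A (sgn u0)"] by linarith
  ultimately show "onorm A \<le> Sup ?S" by (intro onorm_bound)
  show "Sup ?S \<le> onorm A"
  proof (rule cSup_least)
    have "A (sgn u0) \<bullet> axis undefined 1 \<in> ?S" using u1 by force
    then show "?S \<noteq> {}" by blast
  qed (rule le)
qed

end

theory Submission
  imports Defs
begin

text \<open>
  Write \<open>r = A xh - b\<close> for the primal residual and \<open>L = (onorm A)\<^sup>2 / \<gamma>\<close>.

  Everything about the dual function comes from one inequality, \<open>dual_gap\<close>: for \<open>z \<in> Q\<close>,
  the quantity \<open>\<phi> u + f z + u \<bullet> (A z - b)\<close> is at least \<open>\<gamma> / 2 * (norm (z - x u))\<^sup>2\<close>,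
  because \<open>x u\<close> minimises the strongly convex Lagrangian at \<open>u\<close>. It shows that
  \<open>b - A (x u)\<close> is a subgradient, hence the gradient, and that \<open>\<phi>\<close> lies below its
  tangent plus \<open>L / 2\<close> times the squared distance (\<open>dual_smooth\<close>).

  Exact minimisation over the block with the largest partial gradient is at least as good as a
  gradient step in that block, which carries at least the fraction \<open>1 / n\<close> of the squared gradient
  norm. So an iteration with gradient \<open>g\<close> decreases \<open>\<phi>\<close> by at least \<open>(norm g)\<^sup>2 / (2 n L)\<close>
  (\<open>greedy_block_decrease\<close>), and the equation defining the step size turns this into
  \<open>w (Suc k) \<le> n L (a (Suc k))\<^sup>2\<close>, whence \<open>w k\<close> grows like \<open>k\<^sup>2 / (4 n L)\<close>
  (\<open>quadratic_growth\<close>).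

  In an accelerated method the weighted sum of tangents plus \<open>(norm u)\<^sup>2 / 2\<close> is an estimating
  function with minimiser \<open>\<zeta> k\<close>. A tangent of \<open>\<phi>\<close> at \<open>l\<close>, evaluated at \<open>u\<close>, equals
  \<open>- f (x l) - u \<bullet> (A (x l) - b)\<close>, so by convexity of \<open>f\<close> the estimate can be carried along
  directly in terms of the averaged primal point: for \<^emph>\<open>all\<close> \<open>u\<close>,
  \<open>w k * (\<phi> (\<eta> k) + f (xh k) + u \<bullet> r) \<le> (norm u)\<^sup>2 / 2 - (norm (u - \<zeta> k))\<^sup>2 / 2\<close>
  (\<open>aam_step_invariant\<close>). The choice \<open>u = w k *\<^sub>R r\<close>, set against the lower bound
  \<open>- (lstar \<bullet> r) \<le> \<phi> (\<eta> k) + f (xh k)\<close> from weak duality, bounds residual and gap; the choice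
  \<open>u = lstar\<close> with \<open>dual_gap\<close> at \<open>lstar\<close>, where \<open>x lstar = xstar\<close>, bounds the distance to
  \<open>xstar\<close> (\<open>primal_dual_bounds\<close>).

  The operator norm controls \<open>A\<close> only once \<open>A\<close> is known to be bounded, which is first
  derived from the finite dimension of the primal space.
\<close>

section \<open>Linear maps on finite-dimensional normed spaces\<close>

text \<open>
  A vector outside a closed subspace has positive distance \<open>d\<close> from it. By homogeneity this
  controls the coefficient of \<open>v\<close> in any vector of the enlarged span, which is what both of the
  inductions on the spanning set below need.
\<close>

lemma gap_of_closed_span:
  fixes v :: "'a::real_normed_vector"
  assumes closed: "closed (span S)" and v: "v \<notin> span S"
  obtains d where "0 < d" "\<And>t s. s \<in> span S \<Longrightarrow> \<bar>t\<bar> * d \<le> norm (t *\<^sub>R v + s)"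
proof -
  obtain d where d: "0 < d" "\<And>s. s \<in> span S \<Longrightarrow> d \<le> dist v s"
    using closed v by (metis closure_approachable closure_closed dist_commute not_less)
  have "\<bar>t\<bar> * d \<le> norm (t *\<^sub>R v + s)" if s: "s \<in> span S" for t s
  proof (cases "t = 0")
    case False
    have "d \<le> dist v ((- 1 / t) *\<^sub>R s)"
      by (intro d span_scale s)
    then have "\<bar>t\<bar> * d \<le> \<bar>t\<bar> * norm (v + (1 / t) *\<^sub>R s)"
      by (simp add: dist_norm mult_left_mono)
    also have "\<dots> = norm (t *\<^sub>R (v + (1 / t) *\<^sub>R s))"
      by (simp only: norm_scaleR)
    also have "t *\<^sub>R (v + (1 / t) *\<^sub>R s) = t *\<^sub>R v + s"
      using False by (simp add: scaleR_add_right)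
    finally show ?thesis .
  qed simp
  with d(1) show ?thesis by (rule that)
qed

text \<open>
  Adding a vector \<open>v\<close> outside the span keeps completeness: the coefficients of \<open>v\<close> along a
  Cauchy sequence are again Cauchy, so the sequence splits into two convergent parts.
\<close>

lemma complete_span_finite:
  fixes S :: "'a::real_normed_vector set"
  assumes "finite S"
  shows "complete (span S)"
  using assms
proof induction
  case empty
  then show ?case by (simp add: compact_imp_complete)
next
  case (insert v S)
  show ?case
  proof (cases "v \<in> span S")
    case True
    then show ?thesis using insert.IH by (simp add: span_redundant)
  next
    case False
    obtain d where d: "0 < d" "\<And>t s. s \<in> span S \<Longrightarrow> \<bar>t\<bar> * d \<le> norm (t *\<^sub>R v + s)"
      using gap_of_closed_span[OF complete_imp_closed[OF insert.IH] False] by blast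
    show ?thesis
    proof (rule completeI)
      fix y assume y: "\<forall>n. y n \<in> span (insert v S)" and "Cauchy y"
      have "\<exists>t. y n - t *\<^sub>R v \<in> span S" for n
        using y by (simp add: span_breakdown_eq)
      then obtain t where t: "\<And>n. y n - t n *\<^sub>R v \<in> span S" by metis
      have t_le: "\<bar>t m - t n\<bar> * d \<le> norm (y m - y n)" for m n
        using d(2)[OF span_diff[OF t[of m] t[of n]], of "t m - t n"]
        by (simp add: algebra_simps)
      have "Cauchy t"
      proof (rule metric_CauchyI)
        fix e :: real assume "0 < e"
        then have "0 < e * d" using d(1) by simp
        then obtain M where "\<forall>m\<ge>M. \<forall>n\<ge>M. dist (y m) (y n) < e * d"
          using metric_CauchyD[OF \<open>Cauchy y\<close>] by blast
        then have "\<bar>t m - t n\<bar> * d < e * d" if "m \<ge> M" "n \<ge> M" for m n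
          using t_le[of m n] that by (auto simp: dist_norm intro: le_less_trans)
        then show "\<exists>M. \<forall>m\<ge>M. \<forall>n\<ge>M. dist (t m) (t n) < e"
          using d(1) by (auto simp: dist_real_def)
      qed
      then obtain T where T: "t \<longlonglongrightarrow> T" using Cauchy_convergent convergent_def by blast
      have "Cauchy (\<lambda>n. t n *\<^sub>R v)"
        using tendsto_scaleR[OF T tendsto_const] by (rule LIMSEQ_imp_Cauchy)
      have "Cauchy (\<lambda>n. y n - t n *\<^sub>R v)"
      proof (rule metric_CauchyI)
        fix e :: real assume "0 < e"
        then obtain M M' where M:
          "\<forall>m\<ge>M. \<forall>n\<ge>M. dist (y m) (y n) < e / 2"
          "\<forall>m\<ge>M'. \<forall>n\<ge>M'. dist (t m *\<^sub>R v) (t n *\<^sub>R v) < e / 2"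
          using metric_CauchyD[OF \<open>Cauchy y\<close>] metric_CauchyD[OF \<open>Cauchy (\<lambda>n. t n *\<^sub>R v)\<close>]
          by (meson half_gt_zero)
        have "dist (y m - t m *\<^sub>R v) (y n - t n *\<^sub>R v) < e"
          if mn: "m \<ge> max M M'" "n \<ge> max M M'" for m n
        proof -
          have "dist (y m - t m *\<^sub>R v) (y n - t n *\<^sub>R v)
              \<le> dist (y m) (y n) + dist (t m *\<^sub>R v) (t n *\<^sub>R v)"
            using norm_triangle_ineq4[of "y m - y n" "t m *\<^sub>R v - t n *\<^sub>R v"]
            by (simp add: dist_norm algebra_simps)
          moreover have "dist (y m) (y n) < e / 2" using M(1) mn by simp
          moreover have "dist (t m *\<^sub>R v) (t n *\<^sub>R v) < e / 2" using M(2) mn by simp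
          ultimately show ?thesis by linarith
        qed
        then show "\<exists>M. \<forall>m\<ge>M. \<forall>n\<ge>M. dist (y m - t m *\<^sub>R v) (y n - t n *\<^sub>R v) < e"
          by blast
      qed
      then obtain s where s: "s \<in> span S" "(\<lambda>n. y n - t n *\<^sub>R v) \<longlonglongrightarrow> s"
        using insert.IH t by (rule_tac completeE) auto
      have "(\<lambda>n. (y n - t n *\<^sub>R v) + t n *\<^sub>R v) \<longlonglongrightarrow> s + T *\<^sub>R v"
        by (intro tendsto_add s tendsto_scaleR T tendsto_const)
      then have "y \<longlonglongrightarrow> s + T *\<^sub>R v" by simp
      moreover have "s + T *\<^sub>R v \<in> span (insert v S)"
        using s(1) by (auto simp: span_breakdown_eq intro!: exI[of _ T])
      ultimately show "\<exists>z\<in>span (insert v S). y \<longlonglongrightarrow> z" by blast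
    qed
  qed
qed

lemma bounded_linear_of_finite_span:
  fixes A :: "'a::real_normed_vector \<Rightarrow> 'b::real_normed_vector"
  assumes A: "linear A" and "finite D" "span (D :: 'a set) = UNIV"
  shows "bounded_linear A"
proof -
  have "\<exists>C. \<forall>y\<in>span D. norm (A y) \<le> C * norm y"
    using \<open>finite D\<close>
  proof induction
    case empty
    then show ?case using A by (simp add: linear_0)
  next
    case (insert v S)
    then obtain C where C: "\<And>y. y \<in> span S \<Longrightarrow> norm (A y) \<le> C * norm y" by blast
    show ?case
    proof (cases "v \<in> span S")
      case True
      then show ?thesis using C by (auto simp: span_redundant)
    next
      case False
      obtain d where d: "0 < d" "\<And>t s. s \<in> span S \<Longrightarrow> \<bar>t\<bar> * d \<le> norm (t *\<^sub>R v + s)"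
        using gap_of_closed_span[OF complete_imp_closed[OF complete_span_finite] False] insert
        by blast
      have "norm (A y) \<le> (norm (A v) / d + \<bar>C\<bar> * (1 + norm v / d)) * norm y"
        if y: "y \<in> span (insert v S)" for y
      proof -
        obtain t where s: "y - t *\<^sub>R v \<in> span S" using y unfolding span_breakdown_eq by blast
        have t: "\<bar>t\<bar> \<le> norm y / d"
          using d(2)[OF s, of t] d(1) by (simp add: pos_le_divide_eq)
        have "A y = t *\<^sub>R A v + A (y - t *\<^sub>R v)"
          using A by (simp add: linear_diff linear_cmul)
        then have "norm (A y) \<le> \<bar>t\<bar> * norm (A v) + norm (A (y - t *\<^sub>R v))"
          by (metis norm_triangle_ineq norm_scaleR)
        also have "norm (A (y - t *\<^sub>R v)) \<le> \<bar>C\<bar> * norm (y - t *\<^sub>R v)"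
          using C[OF s] by (rule order_trans) (simp add: mult_right_mono)
        also have "norm (y - t *\<^sub>R v) \<le> norm y + \<bar>t\<bar> * norm v"
          using norm_triangle_ineq4[of y "t *\<^sub>R v"] by simp
        also have "\<bar>t\<bar> * norm (A v) + \<bar>C\<bar> * (norm y + \<bar>t\<bar> * norm v)
            \<le> norm y / d * norm (A v) + \<bar>C\<bar> * (norm y + norm y / d * norm v)"
          using d(1) by (intro add_mono mult_mono t order_refl) auto
        finally show ?thesis by (simp add: mult_left_mono) (simp add: algebra_simps)
      qed
      then show ?thesis by blast
    qed
  qed
  then obtain C where "\<And>y. norm (A y) \<le> C * norm y" using assms(3) by auto
  then show ?thesis
    using A by (intro bounded_linear_intro[of A C]) (auto simp: linear_add linear_cmul mult.commute)
qed

section \<open>Strong convexity and gradients\<close>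

text \<open>
  The form in which first-order conditions enter: a minimality condition along a segment,
  divided by the step length \<open>t\<close>, leaves a remainder of order \<open>t\<close>.
\<close>

lemma nonneg_of_perturbations:
  fixes p q :: real
  assumes "\<And>t. 0 < t \<Longrightarrow> t \<le> 1 \<Longrightarrow> 0 \<le> p + t * q"
  shows "0 \<le> p"
proof (rule tendsto_lowerbound)
  have "((\<lambda>t. p + t * q) \<longlongrightarrow> p + 0 * q) (at_right 0)" by (intro tendsto_intros)
  then show "((\<lambda>t. p + t * q) \<longlongrightarrow> p) (at_right 0)" by simp
  show "\<forall>\<^sub>F t in at_right 0. 0 \<le> p + t * q"
    using assms by (intro eventually_at_rightI[of 0 1]) auto
qed simp

lemma strongly_convex_onD:
  assumes "strongly_convex_on \<gamma> Q f" "x \<in> Q" "y \<in> Q" "0 \<le> t" "t \<le> 1"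
  shows "f (t *\<^sub>R x + (1 - t) *\<^sub>R y)
           \<le> t * f x + (1 - t) * f y - \<gamma> / 2 * t * (1 - t) * (norm (x - y))\<^sup>2"
  using assms by (auto simp: strongly_convex_on_def)

lemma strongly_convex_on_convex:
  assumes "strongly_convex_on \<gamma> Q f" "0 \<le> \<gamma>"
  shows "convex_on Q f"
proof (rule convex_onI)
  show "convex Q" using assms(1) by (simp add: strongly_convex_on_def)
  fix t x y assume t: "(0::real) < t" "t < 1" and xy: "x \<in> Q" "y \<in> Q"
  have "f ((1 - t) *\<^sub>R x + (1 - (1 - t)) *\<^sub>R y)
      \<le> (1 - t) * f x + (1 - (1 - t)) * f y - \<gamma> / 2 * (1 - t) * (1 - (1 - t)) * (norm (x - y))\<^sup>2"
    using t by (intro strongly_convex_onD[OF assms(1) xy]) auto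
  moreover have "0 \<le> \<gamma> / 2 * (1 - t) * (1 - (1 - t)) * (norm (x - y))\<^sup>2"
    using t assms(2) by simp
  ultimately show "f ((1 - t) *\<^sub>R x + t *\<^sub>R y) \<le> (1 - t) * f x + t * f y" by simp
qed

text \<open>
  Comparing the minimiser with the point \<open>t *\<^sub>R z + (1 - t) *\<^sub>R z0\<close>, dividing by \<open>t\<close> and
  letting \<open>t\<close> tend to 0 turns strong convexity into quadratic growth. The linear term \<open>T\<close> does
  not affect the modulus, and it makes the lemma applicable to Lagrangians.
\<close>

lemma strongly_convex_growth:
  assumes f: "strongly_convex_on \<gamma> Q f" and T: "linear T"
    and z0: "z0 \<in> Q" "\<And>z. z \<in> Q \<Longrightarrow> f z0 + T z0 \<le> f z + T z" and z: "z \<in> Q"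
  shows "f z0 + T z0 + \<gamma> / 2 * (norm (z - z0))\<^sup>2 \<le> f z + T z"
proof -
  define D where "D = \<gamma> / 2 * (norm (z - z0))\<^sup>2"
  have "0 \<le> (f z + T z - f z0 - T z0 - D) + t * D" if t: "0 < t" "t \<le> 1" for t
  proof -
    let ?y = "t *\<^sub>R z + (1 - t) *\<^sub>R z0"
    have "?y \<in> Q" using f z z0(1) t by (auto simp: strongly_convex_on_def intro!: convexD)
    then have "f z0 + T z0 \<le> f ?y + T ?y" by (rule z0)
    also have "T ?y = t * T z + (1 - t) * T z0" using T by (simp add: linear_add linear_cmul)
    also have "f ?y \<le> t * f z + (1 - t) * f z0 - \<gamma> / 2 * t * (1 - t) * (norm (z - z0))\<^sup>2"
      using t by (intro strongly_convex_onD[OF f z z0(1)]) auto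
    also have "\<gamma> / 2 * t * (1 - t) * (norm (z - z0))\<^sup>2 = t * (1 - t) * D"
      by (simp add: D_def)
    finally have "0 \<le> t * ((f z + T z - f z0 - T z0 - D) + t * D)"
      by (simp add: algebra_simps)
    then show ?thesis using t by (simp add: zero_le_mult_iff)
  qed
  then have "0 \<le> f z + T z - f z0 - T z0 - D" by (rule nonneg_of_perturbations)
  then show ?thesis by (simp add: D_def)
qed

text \<open>
  The difference between \<open>\<phi>\<close> and the supporting affine function has a minimum at \<open>u\<close>.
\<close>

lemma gradient_unique_subgradient:
  fixes \<phi> :: "'h::real_inner \<Rightarrow> real"
  assumes d: "GDERIV \<phi> u :> d" and g: "\<And>v. \<phi> u + (v - u) \<bullet> g \<le> \<phi> v"
  shows "d = g"
proof -
  have "((\<lambda>v. \<phi> v - v \<bullet> g) has_derivative (\<lambda>h. h \<bullet> d - h \<bullet> g)) (at u)"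
    using d unfolding gderiv_def by (auto intro!: derivative_eq_intros)
  then have "(\<lambda>h. h \<bullet> d - h \<bullet> g) = (\<lambda>h. 0)"
    by (rule has_derivative_local_min) (use g in \<open>auto simp: inner_diff_left algebra_simps\<close>)
  then have "(d - g) \<bullet> d - (d - g) \<bullet> g = 0" by metis
  then show ?thesis by (simp flip: inner_diff_right)
qed

section \<open>The dual function of a strongly convex problem\<close>

locale dual_problem =
  fixes Q :: "'e::real_normed_vector set" and f :: "'e \<Rightarrow> real"
    and A :: "'e \<Rightarrow> 'h::real_inner" and b :: 'h and \<gamma> :: real and x :: "'h \<Rightarrow> 'e"
  assumes \<gamma>: "0 < \<gamma>" and f: "strongly_convex_on \<gamma> Q f" and A: "bounded_linear A"
    and x: "\<And>u. is_arg_max (\<lambda>z. - f z - adj A u z) (\<lambda>z. z \<in> Q) (x u)"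
begin

abbreviation \<phi> :: "'h \<Rightarrow> real" where "\<phi> \<equiv> dual_fun Q f A b"

abbreviation L :: real where "L \<equiv> (onorm A)\<^sup>2 / \<gamma>"

lemma x_in: "x u \<in> Q"
  using x by (simp add: is_arg_max_def)

lemma x_max: "z \<in> Q \<Longrightarrow> f (x u) + u \<bullet> A (x u) \<le> f z + u \<bullet> A z"
  using x[of u] by (force simp: is_arg_max_def adj_def not_less)

lemma dual_eq: "\<phi> u = - f (x u) + u \<bullet> (b - A (x u))"
proof -
  have "(SUP z\<in>Q. - f z - adj A u z) = - f (x u) - adj A u (x u)"
  proof (rule cSup_eq_maximum)
    show "- f (x u) - adj A u (x u) \<in> (\<lambda>z. - f z - adj A u z) ` Q"
      using x_in by blast
    show "y \<le> - f (x u) - adj A u (x u)" if "y \<in> (\<lambda>z. - f z - adj A u z) ` Q" for y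
      using that x_max[of _ u] by (force simp: adj_def)
  qed
  then show ?thesis by (simp add: dual_fun_def adj_def inner_diff_right)
qed

text \<open>
  Weak duality with a quantitative remainder: the right-hand side is the amount by which \<open>z\<close>
  fails to minimise the Lagrangian \<open>f z + u \<bullet> (A z - b)\<close>, whose minimum is \<open>- \<phi> u\<close>.
\<close>

lemma dual_gap:
  assumes z: "z \<in> Q"
  shows "\<gamma> / 2 * (norm (z - x u))\<^sup>2 \<le> \<phi> u + f z + u \<bullet> (A z - b)"
proof -
  have "linear (\<lambda>z. u \<bullet> A z)"
    using A by (intro linearI) (simp_all add: linear_simps inner_add_right)
  from strongly_convex_growth[OF f this x_in x_max z] show ?thesis
    by (simp add: dual_eq inner_diff_right)
qed

text \<open>
  Read as a function of \<open>v\<close>, the tangent of \<open>\<phi>\<close> at \<open>u\<close> is the negative Lagrangian at the fixed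
  primal point \<open>x u\<close>.
\<close>

lemma dual_tangent: "\<phi> u + (v - u) \<bullet> (b - A (x u)) = - f (x u) + v \<bullet> (b - A (x u))"
  by (simp add: dual_eq inner_diff_left)

lemma dual_subgradient: "\<phi> u + (v - u) \<bullet> (b - A (x u)) \<le> \<phi> v"
proof -
  have "0 \<le> \<gamma> / 2 * (norm (x u - x v))\<^sup>2" using \<gamma> by simp
  also have "\<dots> \<le> \<phi> v + f (x u) + v \<bullet> (A (x u) - b)" by (rule dual_gap[OF x_in])
  finally show ?thesis unfolding dual_tangent by (simp add: inner_diff_right)
qed

lemma dual_gradient: "GDERIV \<phi> u :> d \<Longrightarrow> d = b - A (x u)"
  using gradient_unique_subgradient dual_subgradient by blast

text \<open>
  Moving from \<open>u\<close> to \<open>v\<close> displaces the maximiser by a distance \<open>p\<close>. This gains at most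
  \<open>onorm A * norm (v - u) * p\<close> over the tangent, while strong convexity costs
  \<open>\<gamma> / 2 * p\<^sup>2\<close>; Young's inequality maximises the difference over \<open>p\<close>.
\<close>

lemma dual_smooth: "\<phi> v \<le> \<phi> u + (v - u) \<bullet> (b - A (x u)) + L / 2 * (norm (v - u))\<^sup>2"
proof -
  let ?p = "norm (x v - x u)" and ?q = "onorm A * norm (v - u)"
  have "(v - u) \<bullet> A (x u - x v) \<le> norm (v - u) * norm (A (x u - x v))"
    by (rule norm_cauchy_schwarz)
  also have "\<dots> \<le> norm (v - u) * (onorm A * norm (x u - x v))"
    by (intro mult_left_mono onorm A norm_ge_zero)
  finally have cs: "(v - u) \<bullet> A (x u - x v) \<le> ?q * ?p"
    by (simp add: norm_minus_commute mult_ac)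
  have "0 \<le> (\<gamma> * ?p - ?q)\<^sup>2 / (2 * \<gamma>)" using \<gamma> by simp
  also have "\<dots> = \<gamma> / 2 * ?p\<^sup>2 - ?q * ?p + ?q\<^sup>2 / (2 * \<gamma>)"
    using \<gamma> by (simp add: power2_eq_square field_simps)
  finally have young: "?q * ?p \<le> \<gamma> / 2 * ?p\<^sup>2 + ?q\<^sup>2 / (2 * \<gamma>)" by simp
  have "\<phi> v = - f (x v) - u \<bullet> A (x v) + v \<bullet> b - (v - u) \<bullet> A (x v)"
    by (simp add: dual_eq inner_diff_left inner_diff_right)
  also have "\<dots> \<le> \<phi> u + (v - u) \<bullet> (b - A (x u)) + (v - u) \<bullet> A (x u - x v) - \<gamma> / 2 * ?p\<^sup>2"
    using dual_gap[OF x_in, of v u] A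
    by (simp add: inner_diff_left inner_diff_right linear_simps)
  also have "\<dots> \<le> \<phi> u + (v - u) \<bullet> (b - A (x u)) + ?q\<^sup>2 / (2 * \<gamma>)"
    using cs young by simp
  finally show ?thesis by (simp add: power_mult_distrib)
qed

lemma dual_segment_derivative:
  assumes "\<And>t. 0 < t \<Longrightarrow> t \<le> 1 \<Longrightarrow> \<phi> u \<le> \<phi> (u + t *\<^sub>R h)"
  shows "0 \<le> h \<bullet> (b - A (x u))"
proof (rule nonneg_of_perturbations)
  fix t :: real assume t: "0 < t" "t \<le> 1"
  have "\<phi> u \<le> \<phi> u + t * (h \<bullet> (b - A (x u))) + L / 2 * (t * norm h)\<^sup>2"
    using assms[OF t] dual_smooth[of "u + t *\<^sub>R h" u] t by simp
  then have "0 \<le> t * (h \<bullet> (b - A (x u)) + t * (L / 2 * (norm h)\<^sup>2))"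
    by (simp add: power2_eq_square algebra_simps)
  then show "0 \<le> h \<bullet> (b - A (x u)) + t * (L / 2 * (norm h)\<^sup>2)"
    using t by (simp add: zero_le_mult_iff)
qed

end

section \<open>One block minimisation\<close>

lemma norm_le_greedy_block:
  fixes v :: "real^'m"
  assumes B: "block_partition n B"
    and p: "is_arg_max (\<lambda>p. (norm (block_part (B p) v))\<^sup>2) (\<lambda>p. p \<in> {1..n}) p"
  shows "(norm v)\<^sup>2 \<le> real n * (norm (block_part (B p) v))\<^sup>2"
proof -
  have sq: "(norm y)\<^sup>2 = (\<Sum>j\<in>UNIV. (y $ j)\<^sup>2)" for y :: "real^'m"
    unfolding dot_square_norm[symmetric] inner_vec_def by (simp add: power2_eq_square)
  have "(v $ j)\<^sup>2 \<le> (\<Sum>q\<in>{1..n}. (block_part (B q) v $ j)\<^sup>2)" for j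
  proof -
    obtain q where q: "q \<in> {1..n}" "j \<in> B q"
      using B unfolding block_partition_def partition_on_def by blast
    then have "(v $ j)\<^sup>2 = (block_part (B q) v $ j)\<^sup>2" by (simp add: block_part_def)
    also have "\<dots> \<le> (\<Sum>q\<in>{1..n}. (block_part (B q) v $ j)\<^sup>2)"
      using q(1) by (intro member_le_sum) auto
    finally show ?thesis .
  qed
  then have "(norm v)\<^sup>2 \<le> (\<Sum>j\<in>UNIV. \<Sum>q\<in>{1..n}. (block_part (B q) v $ j)\<^sup>2)"
    unfolding sq by (rule sum_mono)
  also have "\<dots> = (\<Sum>q\<in>{1..n}. (norm (block_part (B q) v))\<^sup>2)"
    unfolding sq by (rule sum.swap)
  also have "\<dots> \<le> (\<Sum>q\<in>{1..n}. (norm (block_part (B p) v))\<^sup>2)"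
    using p by (intro sum_mono) (auto simp: is_arg_max_def not_less)
  finally show ?thesis by simp
qed

text \<open>
  The block minimiser competes with the gradient step of length \<open>1 / L\<close> inside the block, and the
  largest of \<open>n\<close> blocks carries at least the fraction \<open>1 / n\<close> of the squared gradient norm.
\<close>

lemma greedy_block_decrease:
  fixes \<phi> :: "real^'m \<Rightarrow> real"
  assumes L: "0 < L" and B: "block_partition n B"
    and smooth: "\<And>v. \<phi> v \<le> \<phi> u + (v - u) \<bullet> g + L / 2 * (norm (v - u))\<^sup>2"
    and p: "is_arg_max (\<lambda>p. (norm (block_part (B p) g))\<^sup>2) (\<lambda>p. p \<in> {1..n}) p"
    and y: "is_arg_min \<phi> (\<lambda>y. y \<in> block_subspace (B p) u) y"
  shows "\<phi> y \<le> \<phi> u - (norm g)\<^sup>2 / (2 * real n * L)"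
proof -
  let ?g = "block_part (B p) g"
  have n: "0 < real n" using p by (auto simp: is_arg_max_def)
  have "u - (1 / L) *\<^sub>R ?g \<in> block_subspace (B p) u"
    by (simp add: block_subspace_def block_part_def)
  then have "\<phi> y \<le> \<phi> (u - (1 / L) *\<^sub>R ?g)" using y by (force simp: is_arg_min_def not_less)
  also have "\<dots> \<le> \<phi> u - (?g \<bullet> g) / L + L / 2 * ((norm ?g) / L)\<^sup>2"
    using smooth[of "u - (1 / L) *\<^sub>R ?g"] L by simp
  also have "?g \<bullet> g = (norm ?g)\<^sup>2"
    unfolding dot_square_norm[symmetric] inner_vec_def
    by (intro sum.cong) (auto simp: block_part_def)
  also have "\<phi> u - (norm ?g)\<^sup>2 / L + L / 2 * ((norm ?g) / L)\<^sup>2 = \<phi> u - (norm ?g)\<^sup>2 / (2 * L)"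
    using L by (simp add: power2_eq_square field_simps)
  also have "\<dots> \<le> \<phi> u - (norm g)\<^sup>2 / (2 * real n * L)"
    using norm_le_greedy_block[OF B p] n L by (simp add: field_simps)
  finally show ?thesis .
qed

section \<open>Growth of the weights\<close>

text \<open>
  The weights satisfy \<open>w (Suc j) - w j = a (Suc j) \<ge> sqrt (w (Suc j) / c)\<close>, a discrete form of
  \<open>w' \<ge> sqrt (w / c)\<close>, whose solution is \<open>t\<^sup>2 / (4 * c)\<close>.
\<close>

lemma quadratic_growth:
  fixes a w :: "nat \<Rightarrow> real"
  assumes "w 0 = 0" and c: "0 < c"
    and step: "\<And>j. j < k \<Longrightarrow> 0 < a (Suc j) \<and> w (Suc j) = w j + a (Suc j) \<and>
                             w (Suc j) \<le> c * (a (Suc j))\<^sup>2"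
  shows "(real k)\<^sup>2 \<le> 4 * c * w k"
  using step
proof (induction k)
  case 0
  then show ?case by (simp add: \<open>w 0 = 0\<close>)
next
  case (Suc k)
  \<comment> \<open>In units of \<open>1 / (4 * c)\<close> the weight increases by \<open>2 * p\<close>, so \<open>p \<ge> k + 1 / 2\<close> is exactly
      what leads from \<open>k\<^sup>2\<close> to \<open>(k + 1)\<^sup>2\<close>. A smaller \<open>p\<close> would contradict
      \<open>k\<^sup>2 + 2 * p \<le> p\<^sup>2\<close>.\<close>
  define p where "p = 2 * c * a (Suc k)"
  have p: "0 < p" using c Suc.prems[of k] by (simp add: p_def)
  have IH: "(real k)\<^sup>2 \<le> 4 * c * w k" by (rule Suc.IH) (rule Suc.prems, simp)
  have y: "4 * c * w (Suc k) = 4 * c * w k + 2 * p"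
    using Suc.prems[of k] by (simp add: p_def algebra_simps)
  have "4 * c * w (Suc k) \<le> 4 * c * (c * (a (Suc k))\<^sup>2)"
    using Suc.prems[of k] c by (intro mult_left_mono) auto
  then have sq: "4 * c * w (Suc k) \<le> p\<^sup>2" by (simp add: p_def power2_eq_square algebra_simps)
  have "real k + 1 / 2 \<le> p"
  proof (rule ccontr)
    assume "\<not> real k + 1 / 2 \<le> p"
    moreover have "(real k)\<^sup>2 < (p - 1)\<^sup>2"
      using IH y sq by (simp add: power2_eq_square algebra_simps)
    then have "real k < \<bar>p - 1\<bar>" using power2_less_imp_less[of "real k" "\<bar>p - 1\<bar>"] by simp
    moreover have "2 \<le> p"
    proof -
      have "0 \<le> (real k)\<^sup>2" by simp
      then have "2 * p \<le> p * p" using IH y sq unfolding power2_eq_square by linarith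
      then show ?thesis using p by simp
    qed
    ultimately show False by linarith
  qed
  then show ?case using IH y by (simp add: power2_eq_square algebra_simps)
qed

section \<open>The primal-dual estimate\<close>

context dual_problem
begin

text \<open>
  One step of the estimating-function argument. The tangent at \<open>l\<close>, added with weight \<open>a\<close>, moves
  the minimiser of the quadratic from \<open>\<zeta>\<close> to \<open>\<zeta>'\<close> and its value at the
  new minimiser is lower than at \<open>\<zeta>\<close> by \<open>a\<^sup>2 / 2 * (norm g)\<^sup>2\<close>, where
  \<open>g = b - A (x l)\<close>; this is the decrease of \<open>(w + a) * \<phi>\<close> prescribed by the step size
  equation. What remains is \<open>a * ((\<zeta> - l) \<bullet> g)\<close>, which the line search makes nonnegative.
  For \<open>w = 0\<close> the old average \<open>xh\<close> has no influence and may lie outside \<open>Q\<close>.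
\<close>

lemma aam_step_invariant:
  assumes \<eta>: "\<phi> l \<le> \<phi> \<eta>" and \<zeta>: "0 \<le> (\<zeta> - l) \<bullet> (b - A (x l))"
    and w: "0 \<le> w" "w = 0 \<or> xh \<in> Q" and a: "0 < a"
    and IH: "w * (\<phi> \<eta> + f xh + u \<bullet> (A xh - b)) \<le> (norm u)\<^sup>2 / 2 - (norm (u - \<zeta>))\<^sup>2 / 2"
    and \<eta>': "\<phi> l - a\<^sup>2 / (2 * (w + a)) * (norm (b - A (x l)))\<^sup>2 = \<phi> \<eta>'"
    and \<zeta>': "\<zeta>' = \<zeta> - a *\<^sub>R (b - A (x l))"
    and xh': "xh' = (1 / (w + a)) *\<^sub>R (a *\<^sub>R x l + w *\<^sub>R xh)"
  shows "xh' \<in> Q"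
    and "(w + a) * (\<phi> \<eta>' + f xh' + u \<bullet> (A xh' - b)) \<le> (norm u)\<^sup>2 / 2 - (norm (u - \<zeta>'))\<^sup>2 / 2"
proof -
  define g where "g = b - A (x l)"
  have wa: "0 < w + a" using w a by simp
  have "xh' \<in> Q \<and> (w + a) * f xh' \<le> a * f (x l) + w * f xh"
  proof (cases "w = 0")
    case True
    then show ?thesis using a x_in by (simp add: xh')
  next
    case False
    then have xh: "xh \<in> Q" using w by simp
    have conv: "convex_on Q f" using f \<gamma> by (intro strongly_convex_on_convex) auto
    define t where "t = w / (w + a)"
    have t: "0 \<le> t" "t \<le> 1" "1 - t = a / (w + a)"
      using w a by (auto simp: t_def field_simps)
    have eq: "xh' = (1 - t) *\<^sub>R x l + t *\<^sub>R xh"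
      unfolding t(3) by (simp add: xh' t_def scaleR_add_right)
    have "xh' \<in> Q"
      unfolding eq using f x_in xh t(1,2)
      by (intro convexD) (auto simp: strongly_convex_on_def)
    moreover have "f xh' \<le> (1 - t) * f (x l) + t * f xh"
      unfolding eq by (intro convex_onD[OF conv] t(1,2) x_in xh)
    then have "(w + a) * f xh' \<le> (w + a) * ((1 - t) * f (x l) + t * f xh)"
      using wa by (intro mult_left_mono) auto
    then have "(w + a) * f xh' \<le> a * f (x l) + w * f xh"
      unfolding t(3) using wa by (simp add: t_def distrib_left)
    ultimately show ?thesis by blast
  qed
  then show "xh' \<in> Q" by blast
  from \<open>xh' \<in> Q \<and> _\<close> have fle: "(w + a) * f xh' \<le> a * f (x l) + w * f xh" by blast
  have "(w + a) *\<^sub>R xh' = a *\<^sub>R x l + w *\<^sub>R xh" using wa by (simp add: xh')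
  then have "(w + a) *\<^sub>R A xh' = a *\<^sub>R A (x l) + w *\<^sub>R A xh"
    using A by (metis linear_simps(1,5))
  then have "(w + a) *\<^sub>R (A xh' - b) = w *\<^sub>R (A xh - b) - a *\<^sub>R g"
    by (simp add: g_def algebra_simps)
  then have lin: "(w + a) * (u \<bullet> (A xh' - b)) = w * (u \<bullet> (A xh - b)) - a * (u \<bullet> g)"
    by (metis inner_diff_right inner_scaleR_right)
  have \<phi>': "(w + a) * \<phi> \<eta>' = (w + a) * \<phi> l - a\<^sup>2 / 2 * (norm g)\<^sup>2"
    unfolding \<eta>'[symmetric] g_def using wa by (simp add: field_simps)
  have "w * \<phi> l \<le> w * \<phi> \<eta>" using w \<eta> by (intro mult_left_mono) auto
  then have "(w + a) * (\<phi> \<eta>' + f xh' + u \<bullet> (A xh' - b))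
      \<le> w * (\<phi> \<eta> + f xh + u \<bullet> (A xh - b)) + a * (\<phi> l + f (x l) - u \<bullet> g) - a\<^sup>2 / 2 * (norm g)\<^sup>2"
    using fle lin \<phi>' by (simp add: algebra_simps)
  also have "\<phi> l + f (x l) - u \<bullet> g = (l - u) \<bullet> g"
    by (simp add: dual_eq g_def inner_diff_left)
  also have "w * (\<phi> \<eta> + f xh + u \<bullet> (A xh - b)) + a * ((l - u) \<bullet> g) - a\<^sup>2 / 2 * (norm g)\<^sup>2
      \<le> (norm u)\<^sup>2 / 2 - (norm (u - \<zeta>))\<^sup>2 / 2 - a * ((u - \<zeta>) \<bullet> g) - a\<^sup>2 / 2 * (norm g)\<^sup>2"
    using IH mult_nonneg_nonneg[OF less_imp_le[OF a] \<zeta>]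
    by (simp add: g_def[symmetric] inner_diff_left algebra_simps)
  also have "\<dots> = (norm u)\<^sup>2 / 2 - (norm (u - \<zeta>'))\<^sup>2 / 2"
  proof -
    have "u - \<zeta>' = (u - \<zeta>) + a *\<^sub>R g" by (simp add: \<zeta>' g_def)
    then have "(norm (u - \<zeta>'))\<^sup>2 = (norm (u - \<zeta>))\<^sup>2 + 2 * a * ((u - \<zeta>) \<bullet> g) + a\<^sup>2 * (norm g)\<^sup>2"
      unfolding power2_norm_eq_inner
      by (simp only: inner_add_left inner_add_right inner_scaleR_left inner_scaleR_right
            inner_commute[of g "u - \<zeta>"]) (simp add: power2_eq_square algebra_simps)
    then show ?thesis by (simp add: add_divide_distrib)
  qed
  finally show "(w + a) * (\<phi> \<eta>' + f xh' + u \<bullet> (A xh' - b))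
      \<le> (norm u)\<^sup>2 / 2 - (norm (u - \<zeta>'))\<^sup>2 / 2" .
qed

lemma dual_stationary:
  assumes "GDERIV \<phi> u :> d" "is_arg_min \<phi> (\<lambda>u. True) u"
  shows "A (x u) = b"
proof -
  have "d = 0"
    using assms by (intro gradient_unique_subgradient[of \<phi> u]) (auto simp: is_arg_min_def not_less)
  then show ?thesis using dual_gradient[OF assms(1)] by simp
qed

text \<open>
  How the estimate for all multipliers \<open>u\<close> yields the three error bounds, for any \<open>\<eta>\<close>, \<open>xh\<close>
  and weight \<open>w\<close>.
\<close>

lemma primal_dual_bounds:
  assumes min: "is_arg_min \<phi> (\<lambda>u. True) lstar" and R: "norm lstar \<le> R"
    and feasible: "A (x lstar) = b"
    and xstar: "is_arg_min f (\<lambda>z. z \<in> Q \<and> A z = b) xstar"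
    and xh: "xh \<in> Q" and w: "0 < w"
    and cert: "\<And>u. w * (\<phi> \<eta> + f xh + u \<bullet> (A xh - b)) \<le> (norm u)\<^sup>2 / 2"
  shows "\<bar>\<phi> \<eta> + f xh\<bar> \<le> 2 * R\<^sup>2 / w"
    and "norm (A xh - b) \<le> 2 * R / w"
    and "(norm (xh - xstar))\<^sup>2 \<le> R\<^sup>2 / (\<gamma> * w)"
proof -
  define r where "r = A xh - b"
  have R0: "0 \<le> R" using R norm_ge_zero[of lstar] by linarith
  have "0 \<le> \<gamma> / 2 * (norm (xh - x lstar))\<^sup>2" using \<gamma> by simp
  moreover have "\<phi> lstar \<le> \<phi> \<eta>" using min by (simp add: is_arg_min_def not_less)
  ultimately have lower: "- (lstar \<bullet> r) \<le> \<phi> \<eta> + f xh"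
    using dual_gap[OF xh, of lstar] by (simp add: r_def)
  have cs: "lstar \<bullet> r \<le> R * norm r"
    using norm_cauchy_schwarz[of lstar r] R by (meson mult_right_mono norm_ge_zero order_trans)
  \<comment> \<open>The multiplier \<open>w *\<^sub>R r\<close> makes the estimate strongest: it maximises
      \<open>w * (u \<bullet> r) - (norm u)\<^sup>2 / 2\<close>.\<close>
  have "w * (\<phi> \<eta> + f xh) + w * w * (norm r)\<^sup>2 \<le> w * w * (norm r)\<^sup>2 / 2"
    using cert[of "w *\<^sub>R r"] w
    by (simp add: r_def[symmetric] dot_square_norm power_mult_distrib power2_eq_square[of w] algebra_simps)
  then have "w * (\<phi> \<eta> + f xh + w * (norm r)\<^sup>2 / 2) \<le> 0" by (simp add: algebra_simps)
  then have upper: "\<phi> \<eta> + f xh + w * (norm r)\<^sup>2 / 2 \<le> 0" using w by (simp add: mult_le_0_iff)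
  have "norm r * (w * norm r) \<le> norm r * (2 * R)"
    using upper lower cs by (simp add: power2_eq_square algebra_simps)
  then have r: "w * norm r \<le> 2 * R" using R0 by (cases "r = 0") auto
  then show le: "norm (A xh - b) \<le> 2 * R / w"
    using w by (simp add: r_def[symmetric] field_simps)
  have "R * norm r \<le> R * (2 * R / w)"
    using le R0 unfolding r_def by (intro mult_left_mono)
  then have "- (2 * R\<^sup>2 / w) \<le> \<phi> \<eta> + f xh" using lower cs by (simp add: power2_eq_square)
  moreover have "0 \<le> w * (norm r)\<^sup>2" "0 \<le> 2 * R\<^sup>2 / w" using w by auto
  ultimately show "\<bar>\<phi> \<eta> + f xh\<bar> \<le> 2 * R\<^sup>2 / w" using upper by linarith
  \<comment> \<open>As \<open>x lstar\<close> is feasible, there is no duality gap at \<open>lstar\<close>, and the primal solution is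
      \<open>x lstar\<close>.\<close>
  have "\<gamma> / 2 * (norm (xstar - x lstar))\<^sup>2 \<le> \<phi> lstar + f xstar + lstar \<bullet> (A xstar - b)"
    using xstar by (intro dual_gap) (simp add: is_arg_min_def)
  also have "\<dots> = f xstar - f (x lstar)"
    using xstar by (simp add: dual_eq feasible is_arg_min_def)
  also have "\<dots> \<le> 0"
    using xstar x_in feasible by (force simp: is_arg_min_def not_less)
  finally have xs: "xstar = x lstar" using \<gamma> by (simp add: mult_le_0_iff)
  have "(norm lstar)\<^sup>2 \<le> R\<^sup>2" using R by (intro power_mono) auto
  have "w * (\<gamma> / 2 * (norm (xh - xstar))\<^sup>2) \<le> w * (\<phi> lstar + f xh + lstar \<bullet> (A xh - b))"
    unfolding xs using dual_gap[OF xh] w by (intro mult_left_mono) auto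
  also have "\<dots> \<le> w * (\<phi> \<eta> + f xh + lstar \<bullet> (A xh - b))"
    using w \<open>\<phi> lstar \<le> \<phi> \<eta>\<close> by (intro mult_left_mono) auto
  also have "\<dots> \<le> R\<^sup>2 / 2" using cert[of lstar] \<open>(norm lstar)\<^sup>2 \<le> R\<^sup>2\<close> by linarith
  finally show "(norm (xh - xstar))\<^sup>2 \<le> R\<^sup>2 / (\<gamma> * w)"
    using w \<gamma> by (simp add: field_simps)
qed

end

section \<open>Convergence of the method\<close>

text \<open>
  The segment from \<open>l\<close> to \<open>\<zeta>\<close> is part of the searched segment, so \<open>\<zeta> - l\<close> is never a descent
  direction at \<open>l\<close>. This treats interior and boundary minimisers \<open>\<beta>\<close> alike.
\<close>

lemma line_search_optimality:
  fixes \<phi> :: "'h::real_vector \<Rightarrow> real"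
  assumes \<beta>: "is_arg_min (\<lambda>s. \<phi> (\<eta> + s *\<^sub>R (\<zeta> - \<eta>))) (\<lambda>s. s \<in> {0..1}) \<beta>"
    and l: "l = \<beta> *\<^sub>R \<zeta> + (1 - \<beta>) *\<^sub>R \<eta>"
  shows "\<phi> l \<le> \<phi> \<eta>"
    and "0 \<le> t \<Longrightarrow> t \<le> 1 \<Longrightarrow> \<phi> l \<le> \<phi> (l + t *\<^sub>R (\<zeta> - l))"
proof -
  have l': "l = \<eta> + \<beta> *\<^sub>R (\<zeta> - \<eta>)" by (simp add: l algebra_simps)
  have \<beta>01: "0 \<le> \<beta>" "\<beta> \<le> 1" using \<beta> by (auto simp: is_arg_min_def)
  have min: "\<phi> l \<le> \<phi> (\<eta> + s *\<^sub>R (\<zeta> - \<eta>))" if "0 \<le> s" "s \<le> 1" for s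
    using \<beta> that unfolding l' by (auto simp: is_arg_min_def not_less)
  show "\<phi> l \<le> \<phi> \<eta>" using min[of 0] by simp
  assume t: "0 \<le> t" "t \<le> 1"
  let ?s = "\<beta> + t * (1 - \<beta>)"
  have "t * (1 - \<beta>) \<le> 1 * (1 - \<beta>)" using t \<beta>01 by (intro mult_right_mono) auto
  then have "\<phi> l \<le> \<phi> (\<eta> + ?s *\<^sub>R (\<zeta> - \<eta>))" using t \<beta>01 by (intro min) auto
  also have "\<eta> + ?s *\<^sub>R (\<zeta> - \<eta>) = l + t *\<^sub>R (\<zeta> - l)" by (simp add: l' algebra_simps)
  finally show "\<phi> l \<le> \<phi> (l + t *\<^sub>R (\<zeta> - l))" .
qed

text \<open>
  The step size equation and the guaranteed decrease of a block step, with \<open>G\<close> standing for the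
  squared gradient norm.
\<close>

lemma step_weight_bound:
  fixes a w L G :: real and n :: nat
  assumes "0 < n" "0 < L" "0 < w" "0 < G"
    and "\<phi>l - a\<^sup>2 / (2 * w) * G = \<phi>y" and "\<phi>y \<le> \<phi>l - G / (2 * real n * L)"
  shows "w \<le> real n * L * a\<^sup>2"
proof -
  have "G * (1 / (2 * real n * L)) \<le> G * (a\<^sup>2 / (2 * w))" using assms(5,6) by (simp add: mult.commute)
  then have "1 / (2 * real n * L) \<le> a\<^sup>2 / (2 * w)" using assms(4) by (simp only: mult_le_cancel_left_pos)
  then show ?thesis using assms(1-3) by (simp add: field_simps)
qed

theorem theorem3:
  fixes Q :: "'e::real_normed_vector set"
    and f :: "'e \<Rightarrow> real"
    and A :: "'e \<Rightarrow> real^'m"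
    and b :: "real^'m"
    and \<gamma> R :: real
    and \<phi> :: "real^'m \<Rightarrow> real"
    and d\<phi> :: "real^'m \<Rightarrow> real^'m"
    and x :: "real^'m \<Rightarrow> 'e"
    and n :: nat
    and B :: "nat \<Rightarrow> 'm set"
    and lstar :: "real^'m"
    and xstar :: 'e
    and \<beta> a w :: "nat \<Rightarrow> real"
    and l \<eta> \<zeta> :: "nat \<Rightarrow> real^'m"
    and i :: "nat \<Rightarrow> nat"
    and xh :: "nat \<Rightarrow> 'e"
    and N :: enat
  assumes finite_dim: "\<exists>D::'e set. finite D \<and> span D = UNIV"
    and Q: "closed Q" "convex Q"
    and f: "0 < \<gamma>" "strongly_convex_on \<gamma> Q f"
    and A: "linear A"
    and \<phi>: "\<phi> = dual_fun Q f A b"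
    and x: "\<And>u. is_arg_max (\<lambda>z. - f z - adj A u z) (\<lambda>z. z \<in> Q) (x u)"
    and gradient: "\<And>u. GDERIV \<phi> u :> d\<phi> u"
    and lipschitz: "\<exists>L. L-lipschitz_on UNIV d\<phi>"
    and blocks: "block_partition n B"
    and block_min: "\<And>p u. p \<in> {1..n} \<Longrightarrow>
          \<exists>y. is_arg_min \<phi> (\<lambda>y. y \<in> block_subspace (B p) u) y"
    and lstar: "is_arg_min \<phi> (\<lambda>u. True) lstar" "norm lstar \<le> R"
    and xstar: "is_arg_min f (\<lambda>z. z \<in> Q \<and> A z = b) xstar"
    and run: "aam_run n B \<phi> d\<phi> x \<beta> l i \<eta> a w \<zeta> xh N"
  shows "\<forall>k::nat. 1 \<le> k \<and> enat k \<le> N \<longrightarrow>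
      \<bar>\<phi> (\<eta> k) + f (xh k)\<bar> \<le> 8 * real n * (onorm A)\<^sup>2 * R\<^sup>2 / (\<gamma> * (real k)\<^sup>2) \<and>
      norm (A (xh k) - b) \<le> 8 * real n * (onorm A)\<^sup>2 * R / (\<gamma> * (real k)\<^sup>2) \<and>
      norm (xh k - xstar) \<le> 4 * real n * onorm A * R / (\<gamma> * real k)"
proof (intro allI impI)
  fix k :: nat
  assume k: "1 \<le> k \<and> enat k \<le> N"
  obtain D :: "'e set" where D: "finite D" "span D = UNIV" using finite_dim by blast
  have bA: "bounded_linear A" by (rule bounded_linear_of_finite_span[OF A D])
  interpret P: dual_problem Q f A b \<gamma> x
    using f bA x by (simp add: dual_problem_def)
  have g: "d\<phi> u = b - A (x u)" for u using gradient unfolding \<phi> by (rule P.dual_gradient)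
  have iter: "aam_iteration n B \<phi> d\<phi> x \<beta> l i \<eta> a w \<zeta> xh j" if "j < k" for j
  proof -
    have "enat j < N" using that k by (meson enat_ord_simps(2) less_le_trans)
    then show ?thesis using run by (simp add: aam_run_def)
  qed
  have start: "w 0 = 0" "\<zeta> 0 = 0" using run by (simp_all add: aam_run_def)
  \<comment> \<open>If \<open>A\<close> vanished, feasibility of \<open>xstar\<close> would give \<open>b = 0\<close>, so the gradient would vanish and
      the method would stop before its first iteration.\<close>
  have "onorm A \<noteq> 0"
  proof
    assume "onorm A = 0"
    then have A0: "A z = 0" for z using onorm_eq_0[OF bA] by simp
    then have "b = 0" using xstar by (auto simp: is_arg_min_def)
    then have "d\<phi> (l 0) = 0" by (simp add: g A0)
    then show False using iter[of 0] k by (auto simp: aam_iteration_def)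
  qed
  then have nA: "0 < onorm A" using onorm_pos_le[OF bA] by simp
  define L where "L = (onorm A)\<^sup>2 / \<gamma>"
  have L: "0 < L" using nA f(1) by (simp add: L_def)
  have n: "0 < n" using iter[of 0] k by (auto simp: aam_iteration_def is_arg_max_def)
  have inv: "0 \<le> w j \<and> (0 < j \<longrightarrow> 0 < w j) \<and> (0 < w j \<longrightarrow> xh j \<in> Q) \<and>
      (\<forall>u. w j * (\<phi> (\<eta> j) + f (xh j) + u \<bullet> (A (xh j) - b))
           \<le> (norm u)\<^sup>2 / 2 - (norm (u - \<zeta> j))\<^sup>2 / 2)" if "j \<le> k" for j
    using that
  proof (induction j)
    case 0
    then show ?case by (simp add: start)
  next
    case (Suc j)
    have "j < k" using Suc.prems by simp
    note it = iter[OF this, unfolded aam_iteration_def g]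
    have aw: "0 < a (Suc j)" "w (Suc j) = w j + a (Suc j)" using it by auto
    have IH: "0 \<le> w j" "w j = 0 \<or> xh j \<in> Q"
      "w j * (\<phi> (\<eta> j) + f (xh j) + u \<bullet> (A (xh j) - b))
           \<le> (norm u)\<^sup>2 / 2 - (norm (u - \<zeta> j))\<^sup>2 / 2" for u
      using Suc by auto
    have ls: "\<phi> (l j) \<le> \<phi> (\<eta> j)"
      "\<And>t. 0 < t \<Longrightarrow> t \<le> 1 \<Longrightarrow> \<phi> (l j) \<le> \<phi> (l j + t *\<^sub>R (\<zeta> j - l j))"
      using it by (blast intro: line_search_optimality less_imp_le)+
    have "0 \<le> (\<zeta> j - l j) \<bullet> (b - A (x (l j)))"
      using ls(2) unfolding \<phi> by (rule P.dual_segment_derivative)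
    note step = P.aam_step_invariant[OF ls(1)[unfolded \<phi>] this IH(1,2) aw(1) IH(3)[unfolded \<phi>],
        folded \<phi> aw(2), of "\<eta> (Suc j)" "\<zeta> (Suc j)" "xh (Suc j)"]
    have "\<phi> (l j) - (a (Suc j))\<^sup>2 / (2 * w (Suc j)) * (norm (b - A (x (l j))))\<^sup>2 = \<phi> (\<eta> (Suc j))"
      "\<zeta> (Suc j) = \<zeta> j - a (Suc j) *\<^sub>R (b - A (x (l j)))"
      "xh (Suc j) = (1 / w (Suc j)) *\<^sub>R (a (Suc j) *\<^sub>R x (l j) + w j *\<^sub>R xh j)"
      using it by blast+
    note step = step[OF this]
    have w: "0 < w (Suc j)" using aw IH(1) by simp
    show ?case by (intro conjI impI allI step less_imp_le[OF w] w)
  qed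
  have "(real k)\<^sup>2 \<le> 4 * (real n * L) * w k"
  proof (rule quadratic_growth)
    fix j assume j: "j < k"
    note it = iter[OF j, unfolded aam_iteration_def]
    have "\<phi> (\<eta> (Suc j)) \<le> \<phi> (l j) - (norm (d\<phi> (l j)))\<^sup>2 / (2 * real n * L)"
    proof (rule greedy_block_decrease[OF L blocks])
      show "\<phi> v \<le> \<phi> (l j) + (v - l j) \<bullet> d\<phi> (l j) + L / 2 * (norm (v - l j))\<^sup>2" for v
        unfolding \<phi> g L_def by (rule P.dual_smooth)
    qed (use it in auto)
    then have "w (Suc j) \<le> real n * L * (a (Suc j))\<^sup>2"
      using it inv[of "Suc j"] j
      by (intro step_weight_bound[OF n L, of _ "(norm (d\<phi> (l j)))\<^sup>2"]) auto
    then show "0 < a (Suc j) \<and> w (Suc j) = w j + a (Suc j) \<and>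
        w (Suc j) \<le> real n * L * (a (Suc j))\<^sup>2"
      using it by simp
  qed (use start n L in auto)
  then have growth: "1 / w k \<le> 4 * real n * (onorm A)\<^sup>2 / (\<gamma> * (real k)\<^sup>2)"
    using inv[of k] k f(1) by (simp add: L_def field_simps)
  have invk: "0 < w k" "xh k \<in> Q"
    "w k * (\<phi> (\<eta> k) + f (xh k) + u \<bullet> (A (xh k) - b)) \<le> (norm u)\<^sup>2 / 2" for u
  proof -
    show "0 < w k" "xh k \<in> Q" using inv[of k] k by auto
    have "0 \<le> (norm (u - \<zeta> k))\<^sup>2 / 2" by simp
    moreover have "w k * (\<phi> (\<eta> k) + f (xh k) + u \<bullet> (A (xh k) - b))
        \<le> (norm u)\<^sup>2 / 2 - (norm (u - \<zeta> k))\<^sup>2 / 2"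
      using inv[of k] by blast
    ultimately show "w k * (\<phi> (\<eta> k) + f (xh k) + u \<bullet> (A (xh k) - b)) \<le> (norm u)\<^sup>2 / 2"
      by linarith
  qed
  note bounds = P.primal_dual_bounds[OF lstar(1)[unfolded \<phi>] lstar(2)
      P.dual_stationary[OF gradient[unfolded \<phi>] lstar(1)[unfolded \<phi>]]
      xstar invk(2,1) invk(3)[unfolded \<phi>], folded \<phi>]
  have R: "0 \<le> R" using lstar(2) norm_ge_zero[of lstar] by linarith
  have "\<bar>\<phi> (\<eta> k) + f (xh k)\<bar> \<le> (2 * R\<^sup>2) * (1 / w k)" using bounds(1) by simp
  also have "\<dots> \<le> (2 * R\<^sup>2) * (4 * real n * (onorm A)\<^sup>2 / (\<gamma> * (real k)\<^sup>2))"
    by (intro mult_left_mono growth) simp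
  finally have 1: "\<bar>\<phi> (\<eta> k) + f (xh k)\<bar> \<le> 8 * real n * (onorm A)\<^sup>2 * R\<^sup>2 / (\<gamma> * (real k)\<^sup>2)"
    by (simp add: mult_ac)
  have "norm (A (xh k) - b) \<le> (2 * R) * (1 / w k)" using bounds(2) by simp
  also have "\<dots> \<le> (2 * R) * (4 * real n * (onorm A)\<^sup>2 / (\<gamma> * (real k)\<^sup>2))"
    using R by (intro mult_left_mono growth) simp
  finally have 2: "norm (A (xh k) - b) \<le> 8 * real n * (onorm A)\<^sup>2 * R / (\<gamma> * (real k)\<^sup>2)"
    by (simp add: mult_ac)
  \<comment> \<open>This argument gives the factor \<open>2 * sqrt n\<close>, which is at most \<open>4 * n\<close>.\<close>
  have "(norm (xh k - xstar))\<^sup>2 \<le> R\<^sup>2 / \<gamma> * (1 / w k)" using bounds(3) by simp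
  also have "\<dots> \<le> R\<^sup>2 / \<gamma> * (4 * real n * (onorm A)\<^sup>2 / (\<gamma> * (real k)\<^sup>2))"
    using f(1) by (intro mult_left_mono growth) simp
  also have "\<dots> = 4 * real n * (onorm A * R / (\<gamma> * real k))\<^sup>2"
    by (simp add: power_mult_distrib power_divide power2_eq_square mult_ac)
  also have "\<dots> \<le> (4 * real n)\<^sup>2 * (onorm A * R / (\<gamma> * real k))\<^sup>2"
    using n by (intro mult_right_mono self_le_power) auto
  also have "\<dots> = (4 * real n * onorm A * R / (\<gamma> * real k))\<^sup>2"
    by (simp add: power_mult_distrib power_divide)
  finally have 3: "norm (xh k - xstar) \<le> 4 * real n * onorm A * R / (\<gamma> * real k)"
    by (rule power2_le_imp_le) (use R nA f(1) in auto)
  from 1 2 3 show "\<bar>\<phi> (\<eta> k) + f (xh k)\<bar> \<le> 8 * real n * (onorm A)\<^sup>2 * R\<^sup>2 / (\<gamma> * (real k)\<^sup>2) \<and>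
      norm (A (xh k) - b) \<le> 8 * real n * (onorm A)\<^sup>2 * R / (\<gamma> * (real k)\<^sup>2) \<and>
      norm (xh k - xstar) \<le> 4 * real n * onorm A * R / (\<gamma> * real k)"
    by blast
qed

end
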